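(* Let $n,m$ be integers with $n\ge m\ge 1$, let $k\in\mathbb{Z}$ and $a\in\mathbb{C}$ with $a\neq0$. Then \begin{align*} &\sum_{l=0}^{n-m}\frac{\binom{n}{l}}{a^{n-l}}S_{1}(n-l,m)\,P\hat{C}_{l}^{(k)}(0:a)+\sum_{l=0}^{n-1-m}\frac{\binom{n-1}{l}}{a^{n-1-l}}S_{1}(n-1-l,m)\,P\hat{C}_{l}^{(k)}(0:a)\\ &=\left(1-\frac{1}{m}\right)\sum_{l=0}^{n-m}\frac{\binom{n-1}{l}}{a^{n-l}}S_{1}(n-1-l,m-1)\,P\hat{C}_{l}^{(k)}(-1:a)+\frac{1}{m}\sum_{l=0}^{n-m}\frac{\binom{n-1}{l}}{a^{n-l}}S_{1}(n-1-l,m-1)\,P\hat{C}_{l}^{(k-1)}(-1:a). \end{align*}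
   Context: For an integer $k$, $\mathrm{Lif}_k(t)=\sum_{n=0}^{\infty}\frac{t^{n}}{n!\,(n+1)^{k}}$. For $a\neq0$ and any integer $k$, the Poisson-Charlier and poly-Cauchy of the second kind mixed type polynomials $P\hat{C}_n^{(k)}(x:a)$ are defined by $e^{-t}\,\mathrm{Lif}_k\!\left(-\log\left(1+\frac{t}{a}\right)\right)\left(1+\frac{t}{a}\right)^{x}=\sum_{n\ge0}P\hat{C}_n^{(k)}(x:a)\frac{t^n}{n!}$. $S_1(n,l)$ denotes the (signed) Stirling numbers of the first kind, defined by $x(x-1)\cdots(x-n+1)=\sum_{l=0}^{n}S_1(n,l)x^l$. An empty sum is $0$. *)

theory Defs
  imports Complex_Main "HOL-Computational_Algebra.Computational_Algebra"
begin

text \<open>All generating functions are read as formal power series over the complex numbers.\<close>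

definition Lif :: "int \<Rightarrow> complex fps" where
  "Lif k = Abs_fps (\<lambda>n. 1 / (fact n * (of_nat n + 1) powi k))"

definition scaled_X :: "complex \<Rightarrow> complex fps" where
  "scaled_X a = fps_const (1 / a) * fps_X"

text \<open>
  In the library, \<^term>\<open>fps_ln 1\<close> is the series of \<open>log (1 + t)\<close> and \<^term>\<open>fps_binomial x\<close>
  that of \<open>(1 + t) ^ x\<close>, so the substitution of \<open>t / a\<close> is a composition.
\<close>

definition PC_hat_gf :: "int \<Rightarrow> complex \<Rightarrow> complex \<Rightarrow> complex fps" where
  "PC_hat_gf k x a =
     fps_exp (- 1) * (Lif k oo (- (fps_ln 1 oo scaled_X a))) * (fps_binomial x oo scaled_X a)"

definition PC_hat :: "int \<Rightarrow> nat \<Rightarrow> complex \<Rightarrow> complex \<Rightarrow> complex" where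
  "PC_hat k n x a = fact n * fps_nth (PC_hat_gf k x a) n"

lemma PC_hat_gf_eq: "PC_hat_gf k x a = Abs_fps (\<lambda>n. PC_hat k n x a / fact n)"
  by (simp add: PC_hat_def fps_eq_iff)

definition S1 :: "nat \<Rightarrow> nat \<Rightarrow> int" where
  "S1 n l = coeff (\<Prod>i<n. [:- int i, 1:]) l"

lemma S1_falling_factorial:
  fixes x :: int
  shows "(\<Prod>i<n. x - int i) = (\<Sum>l\<le>n. S1 n l * x ^ l)"
proof -
  have deg: "degree (\<Prod>i<n. [:- int i, 1:]) = n"
    by (subst degree_prod_eq_sum_degree) auto
  have "(\<Prod>i<n. x - int i) = poly (\<Prod>i<n. [:- int i, 1:]) x"
    by (simp add: poly_prod)
  also have "\<dots> = (\<Sum>l\<le>n. S1 n l * x ^ l)"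
    unfolding poly_altdef deg S1_def ..
  finally show ?thesis .
qed

end

theory Submission
  imports Defs
begin

text \<open>
  Put \<open>L = log (1 + t/a)\<close>. Since \<open>L\<^sup>m / m!\<close> is the exponential generating function of
  \<open>S\<^sub>1(n,m) / a\<^sup>n\<close>, the left-hand side is \<open>(n-1)!\<close> times the coefficient of \<open>t\<^sup>n\<^sup>-\<^sup>1\<close> in
  \<open>F' + F\<close>, where \<open>F = e\<^sup>-\<^sup>t Lif\<^sub>k(-L) L\<^sup>m / m!\<close>. The factor \<open>e\<^sup>-\<^sup>t\<close> makes the derivative fall only on
  \<open>Lif\<^sub>k(-L) L\<^sup>m / m!\<close>, and the identity \<open>u Lif\<^sub>k'(u) = Lif\<^sub>k\<^sub>-\<^sub>1(u) - Lif\<^sub>k(u)\<close> at \<open>u = -L\<close> turns the result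
  into the right-hand side, the factor \<open>L' = (1/a) (1 + t/a)\<^sup>-\<^sup>1\<close> shifting \<open>x = 0\<close> to \<open>x = -1\<close>.
\<close>

lemma S1_0_Suc [simp]: "S1 0 (Suc m) = 0"
  by (simp add: S1_def)

lemma S1_0_right: "S1 n 0 = (if n = 0 then 1 else 0)"
  by (induction n) (simp_all add: S1_def mult.commute[of _ "[:_, 1:]"])

lemma S1_Suc_Suc: "S1 (Suc n) (Suc m) = S1 n m - int n * S1 n (Suc m)"
  by (simp add: S1_def mult.commute[of _ "[:_, 1:]"])

lemma S1_eq_0: "n < m \<Longrightarrow> S1 n m = 0"
proof (induction n arbitrary: m)
  case 0
  then show ?case by (cases m) auto
next
  case (Suc n)
  then show ?case by (cases m) (auto simp: S1_Suc_Suc)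
qed

text \<open>The prefactor \<open>1 / fact m\<close> absorbs the exponent, so differentiation just
  lowers the index; used for \<open>fps_ln 1\<close> and \<open>scaled_ln a\<close> alike.\<close>

lemma fps_deriv_divided_power:
  fixes f :: "complex fps"
  shows "fps_deriv (fps_const (1 / fact (Suc m)) * f ^ Suc m) =
    fps_const (1 / fact m) * f ^ m * fps_deriv f"
proof -
  have "fps_const (1 / fact (Suc m)) * of_nat (Suc m) = (fps_const (1 / fact m) :: complex fps)"
    by (simp add: fps_of_nat[symmetric] del: of_nat_Suc)
  moreover have "fps_deriv (fps_const (1 / fact (Suc m)) * f ^ Suc m) =
      (fps_const (1 / fact (Suc m)) * of_nat (Suc m)) * (f ^ m * fps_deriv f)"
    by (simp add: fps_deriv_power' mult_ac del: of_nat_Suc power_Suc fact_Suc)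
  ultimately show ?thesis
    by (simp only: mult.assoc)
qed

text \<open>In coefficients, the recurrence of \<open>S1\<close> says that
  \<open>(1 + fps_X) * fps_deriv\<close> lowers the index \<open>m\<close> by one. Divided powers of
  the logarithm obey the same rule.\<close>

lemma fps_ln_power_egf:
  "fps_const (1 / fact m) * fps_ln 1 ^ m = Abs_fps (\<lambda>n. of_int (S1 n m) / fact n :: complex)"
proof (induction m)
  case 0
  show ?case by (auto simp: fps_eq_iff S1_0_right)
next
  case (Suc m)
  let ?E = "\<lambda>m. Abs_fps (\<lambda>n. of_int (S1 n m) / fact n :: complex)"
  have rec: "(1 + fps_X) * fps_deriv (?E (Suc m)) = ?E m"
  proof (rule fps_ext)
    fix n
    show "fps_nth ((1 + fps_X) * fps_deriv (?E (Suc m))) n = fps_nth (?E m) n"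
      by (cases n) (simp_all add: S1_Suc_Suc distrib_right field_simps del: of_nat_Suc)
  qed
  have "fps_deriv (?E (Suc m)) = inverse (1 + fps_X) * ((1 + fps_X) * fps_deriv (?E (Suc m)))"
    by (simp add: mult.assoc[symmetric] inverse_mult_eq_1)
  also have "\<dots> = inverse (1 + fps_X) * (fps_const (1 / fact m) * fps_ln 1 ^ m)"
    by (simp only: rec Suc.IH)
  also have "\<dots> = fps_deriv (fps_const (1 / fact (Suc m)) * fps_ln 1 ^ Suc m)"
    unfolding fps_deriv_divided_power fps_ln_deriv by (simp add: mult_ac)
  \<comment> \<open>Equal derivatives leave only the constant terms to compare; both vanish, on the
    left by \<open>S1_0_Suc\<close>.\<close>
  finally have "?E (Suc m) = fps_const (1 / fact (Suc m)) * fps_ln 1 ^ Suc m"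
    unfolding fps_deriv_eq_iff by simp
  then show ?case ..
qed

lemma sum_choose_egf:
  fixes u v :: "nat \<Rightarrow> complex"
  shows "(\<Sum>l=0..n. of_nat (n choose l) * u (n - l) * v l) =
    fact n * fps_nth (Abs_fps (\<lambda>n. u n / fact n) * Abs_fps (\<lambda>n. v n / fact n)) n"
proof -
  have "fps_nth (Abs_fps (\<lambda>n. u n / fact n) * Abs_fps (\<lambda>n. v n / fact n)) n =
      (\<Sum>l=0..n. v l / fact l * (u (n - l) / fact (n - l)))"
    by (subst mult.commute) (simp add: fps_mult_nth)
  then show ?thesis
    by (simp add: sum_distrib_left binomial_fact field_simps)
qed

text \<open>The operator \<open>t d/dt\<close> multiplies coefficient \<open>n\<close> by
  \<open>n = (n + 1) - 1\<close>, and a factor \<open>n + 1\<close> lowers \<open>k\<close> by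
  one.\<close>

lemma X_deriv_Lif: "fps_X * fps_deriv (Lif k) = Lif (k - 1) - Lif k"
proof (rule fps_ext)
  fix n
  \<comment> \<open>Splitting the integer power \<open>k - 1\<close> requires a nonzero
    base.\<close>
  have "(of_nat n + 1 :: complex) \<noteq> 0"
    by (metis of_nat_Suc of_nat_neq_0 add.commute)
  then have "fps_nth (Lif (k - 1) - Lif k) n = of_nat n * fps_nth (Lif k) n"
    by (simp add: Lif_def power_int_diff diff_divide_distrib[symmetric])
  then show "fps_nth (fps_X * fps_deriv (Lif k)) n = fps_nth (Lif (k - 1) - Lif k) n"
    by (cases n) simp_all
qed

definition scaled_ln :: "complex \<Rightarrow> complex fps" where
  "scaled_ln a = fps_ln 1 oo scaled_X a"

lemma scaled_X_nth_0 [simp]: "fps_nth (scaled_X a) 0 = 0"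
  by (simp add: scaled_X_def)

lemma scaled_ln_nth_0 [simp]: "fps_nth (scaled_ln a) 0 = 0"
  by (simp add: scaled_ln_def)

text \<open>Writing the reciprocal of \<open>1 + t/a\<close> as a binomial series makes it the very
  factor that \<open>PC_hat_gf\<close> has at \<open>x = -1\<close>.\<close>

lemma fps_deriv_scaled_ln:
  "fps_deriv (scaled_ln a) = fps_const (1 / a) * (fps_binomial (- 1) oo scaled_X a)"
proof -
  have "fps_deriv (scaled_X a) = fps_const (1 / a)"
    by (simp add: scaled_X_def)
  then show ?thesis
    by (simp add: scaled_ln_def fps_compose_deriv fps_ln_deriv fps_binomial_minus_one)
qed

lemma scaled_ln_power_egf:
  "fps_const (1 / fact m) * scaled_ln a ^ m =
    Abs_fps (\<lambda>n. of_int (S1 n m) / a ^ n / fact n)"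
proof -
  have "fps_const (1 / fact m) * scaled_ln a ^ m =
      (fps_const (1 / fact m) * fps_ln 1 ^ m) oo scaled_X a"
    by (simp add: scaled_ln_def fps_compose_power fps_compose_mult_distrib)
  also have "\<dots> = Abs_fps (\<lambda>n. of_int (S1 n m) / a ^ n / fact n)"
    unfolding fps_ln_power_egf
    by (simp add: scaled_X_def fps_eq_iff power_divide)
  finally show ?thesis .
qed

lemma scaled_ln_mult_deriv_Lif:
  "scaled_ln a * (fps_deriv (Lif k) oo - scaled_ln a) =
    (Lif k oo - scaled_ln a) - (Lif (k - 1) oo - scaled_ln a)"
proof -
  have "- scaled_ln a * (fps_deriv (Lif k) oo - scaled_ln a) =
      (fps_X * fps_deriv (Lif k)) oo - scaled_ln a"
    by (simp add: fps_compose_mult_distrib)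
  also have "\<dots> = (Lif (k - 1) oo - scaled_ln a) - (Lif k oo - scaled_ln a)"
    by (simp add: X_deriv_Lif fps_compose_sub_distrib)
  finally show ?thesis
    by (simp add: algebra_simps)
qed

text \<open>The derivative of \<open>fps_exp (- 1)\<close> cancels the undifferentiated summand, so
  the product rule acts only on \<open>H (Suc m)\<close> and the \<open>Lif\<close> factor.\<close>

lemma deriv_plus_self_PC_hat_gf:
  fixes a :: complex
  defines "H \<equiv> \<lambda>m. fps_const (1 / fact m) * scaled_ln a ^ m"
  shows "fps_deriv (H (Suc m) * PC_hat_gf k 0 a) + H (Suc m) * PC_hat_gf k 0 a =
    fps_const (1 / a) *
      (fps_const (1 - 1 / of_nat (Suc m)) * (H m * PC_hat_gf k (- 1) a) +
       fps_const (1 / of_nat (Suc m)) * (H m * PC_hat_gf (k - 1) (- 1) a))"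
proof -
  define L where "L = scaled_ln a"
  define B where "B = fps_binomial (- 1) oo scaled_X a"
  define E where "E = fps_exp (- 1 :: complex)"
  define P where "P = Lif k oo - L"
  define Q where "Q = Lif (k - 1) oo - L"
  define R where "R = fps_deriv (Lif k) oo - L"
  define c where "c = fps_const (1 / of_nat (Suc m) :: complex)"
  define d where "d = fps_const (1 / a)"
  have dH: "fps_deriv (H (Suc m)) = H m * (d * B)"
    unfolding H_def fps_deriv_divided_power fps_deriv_scaled_ln d_def B_def ..
  have dP: "fps_deriv P = - (R * (d * B))"
    by (simp add: P_def R_def L_def d_def B_def fps_compose_deriv fps_deriv_scaled_ln)
  have dE: "fps_deriv E = - E"
    by (simp add: E_def flip: fps_const_neg)
  \<comment> \<open>One factor \<open>L\<close> is split off to meet \<open>R\<close>, so that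
    \<open>LR\<close> can eliminate the derivative of \<open>Lif k\<close>.\<close>
  have HS: "H (Suc m) = c * H m * L"
  proof -
    have "fps_const (1 / fact (Suc m)) = c * fps_const (1 / fact m)"
      by (simp add: c_def mult.commute del: of_nat_Suc)
    then show ?thesis
      by (simp add: H_def L_def mult_ac del: fact_Suc)
  qed
  have LR: "L * R = P - Q"
    unfolding L_def R_def P_def Q_def by (rule scaled_ln_mult_deriv_Lif)
  have gf: "PC_hat_gf k 0 a = E * P" "PC_hat_gf k (- 1) a = E * P * B"
    "PC_hat_gf (k - 1) (- 1) a = E * Q * B"
    by (simp_all add: PC_hat_gf_def E_def P_def Q_def B_def L_def scaled_ln_def)
  have c': "fps_const (1 - 1 / of_nat (Suc m)) = 1 - c"
    unfolding c_def fps_const_1_eq_1[symmetric] fps_const_sub ..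
  have "fps_deriv (H (Suc m) * (E * P)) + H (Suc m) * (E * P) =
      E * (fps_deriv (H (Suc m)) * P + H (Suc m) * fps_deriv P)"
    by (simp add: dE algebra_simps)
  also have "\<dots> = E * (H m * (d * B) * P - c * H m * (d * B) * (L * R))"
    unfolding dH dP by (simp add: HS algebra_simps)
  also have "\<dots> = d * ((1 - c) * (H m * (E * P * B)) + c * (H m * (E * Q * B)))"
    unfolding LR by (simp add: algebra_simps)
  finally show ?thesis
    unfolding gf c' c_def[symmetric] d_def[symmetric] .
qed

text \<open>Indices outside \<open>A\<close> have \<open>n - l < m\<close>, where \<open>S1\<close>
  vanishes, so the sum is a full binomial convolution. A free \<open>A\<close> covers closed and
  half-open ranges.\<close>

lemma sum_S1_PC_hat:
  assumes "A \<subseteq> {0..n}" and "\<And>l. l + m \<le> n \<Longrightarrow> l \<in> A"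
  shows "(\<Sum>l\<in>A. of_nat (n choose l) / a ^ (n - l) * of_int (S1 (n - l) m) * PC_hat k l x a) =
    fact n * fps_nth (fps_const (1 / fact m) * scaled_ln a ^ m * PC_hat_gf k x a) n"
proof -
  have "(\<Sum>l\<in>A. of_nat (n choose l) / a ^ (n - l) * of_int (S1 (n - l) m) * PC_hat k l x a) =
      (\<Sum>l=0..n. of_nat (n choose l) * (of_int (S1 (n - l) m) / a ^ (n - l)) * PC_hat k l x a)"
  proof (rule sum.mono_neutral_cong_left)
    show "\<forall>l\<in>{0..n} - A.
        of_nat (n choose l) * (of_int (S1 (n - l) m) / a ^ (n - l)) * PC_hat k l x a = 0"
    proof
      fix l assume "l \<in> {0..n} - A"
      with assms(2)[of l] have "n - l < m" by force
      then show "of_nat (n choose l) * (of_int (S1 (n - l) m) / a ^ (n - l)) * PC_hat k l x a = 0"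
        by (simp add: S1_eq_0)
    qed
  qed (use assms(1) in auto)
  also have "\<dots> = fact n * fps_nth (fps_const (1 / fact m) * scaled_ln a ^ m * PC_hat_gf k x a) n"
    unfolding scaled_ln_power_egf PC_hat_gf_eq by (rule sum_choose_egf)
  finally show ?thesis .
qed

theorem theorem7:
  fixes n m :: nat and k :: int and a :: complex
  assumes "m \<ge> 1" and "n \<ge> m" and "a \<noteq> 0"
  shows "(\<Sum>l=0..n-m. of_nat (n choose l) / a ^ (n-l) * of_int (S1 (n-l) m) * PC_hat k l 0 a)
       + (\<Sum>l=0..<n-m. of_nat ((n-1) choose l) / a ^ (n-1-l) * of_int (S1 (n-1-l) m) * PC_hat k l 0 a)
       = (1 - 1 / of_nat m) *
           (\<Sum>l=0..n-m. of_nat ((n-1) choose l) / a ^ (n-l) * of_int (S1 (n-1-l) (m-1)) * PC_hat k l (-1) a)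
       + 1 / of_nat m *
           (\<Sum>l=0..n-m. of_nat ((n-1) choose l) / a ^ (n-l) * of_int (S1 (n-1-l) (m-1)) * PC_hat (k-1) l (-1) a)"
proof -
  obtain j where m: "m = Suc j" using assms(1) by (cases m) auto
  obtain N where n: "n = Suc N" using assms(1,2) by (cases n) auto
  define H where "H = (\<lambda>m. fps_const (1 / fact m) * scaled_ln a ^ m)"
  have "(\<Sum>l=0..n-m. of_nat (n choose l) / a ^ (n-l) * of_int (S1 (n-l) m) * PC_hat k l 0 a) =
      fact n * fps_nth (H m * PC_hat_gf k 0 a) n"
    unfolding H_def by (rule sum_S1_PC_hat) auto
  \<comment> \<open>Coefficient \<open>N\<close> of a derivative carries the factor
    \<open>N + 1 = n\<close>, which turns \<open>fact N\<close> into \<open>fact n\<close>.\<close>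
  also have "\<dots> = fact N * fps_nth (fps_deriv (H m * PC_hat_gf k 0 a)) N"
    by (simp add: n mult_ac del: fps_deriv_mult)
  finally have s1: "(\<Sum>l=0..n-m. of_nat (n choose l) / a ^ (n-l) * of_int (S1 (n-l) m) * PC_hat k l 0 a) =
      fact N * fps_nth (fps_deriv (H m * PC_hat_gf k 0 a)) N" .
  \<comment> \<open>The half-open range is \<open>l + m \<le> N\<close>, and is empty when
    \<open>n = m\<close>.\<close>
  have s2: "(\<Sum>l=0..<n-m. of_nat ((n-1) choose l) / a ^ (n-1-l) * of_int (S1 (n-1-l) m) * PC_hat k l 0 a) =
      fact N * fps_nth (H m * PC_hat_gf k 0 a) N"
    unfolding H_def n diff_Suc_1 by (rule sum_S1_PC_hat) (auto simp: m)
  have s3: "(\<Sum>l=0..n-m. of_nat ((n-1) choose l) / a ^ (n-l) * of_int (S1 (n-1-l) (m-1)) * PC_hat k' l (-1) a) =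
      1 / a * (fact N * fps_nth (H j * PC_hat_gf k' (- 1) a) N)" for k'
  proof -
    have "(\<Sum>l=0..n-m. of_nat ((n-1) choose l) / a ^ (n-l) * of_int (S1 (n-1-l) (m-1)) * PC_hat k' l (-1) a) =
        1 / a * (\<Sum>l=0..N-j. of_nat (N choose l) / a ^ (N-l) * of_int (S1 (N-l) j) * PC_hat k' l (-1) a)"
      \<comment> \<open>Here \<open>l \<le> N\<close>, so \<open>a ^ (n-l)\<close> has one factor
        \<open>a\<close> more than \<open>a ^ (N-l)\<close>.\<close>
      unfolding sum_distrib_left by (rule sum.cong) (auto simp: m n Suc_diff_le)
    also have "(\<Sum>l=0..N-j. of_nat (N choose l) / a ^ (N-l) * of_int (S1 (N-l) j) * PC_hat k' l (-1) a) =
        fact N * fps_nth (H j * PC_hat_gf k' (- 1) a) N"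
      unfolding H_def by (rule sum_S1_PC_hat) auto
    finally show ?thesis .
  qed
  have "fps_nth (fps_deriv (H m * PC_hat_gf k 0 a) + H m * PC_hat_gf k 0 a) N =
      1 / a * ((1 - 1 / of_nat m) * fps_nth (H j * PC_hat_gf k (- 1) a) N +
        1 / of_nat m * fps_nth (H j * PC_hat_gf (k - 1) (- 1) a) N)"
    unfolding m H_def deriv_plus_self_PC_hat_gf by (simp only: fps_mult_left_const_nth fps_add_nth)
  then have "fps_nth (fps_deriv (H m * PC_hat_gf k 0 a)) N + fps_nth (H m * PC_hat_gf k 0 a) N =
      1 / a * ((1 - 1 / of_nat m) * fps_nth (H j * PC_hat_gf k (- 1) a) N +
        1 / of_nat m * fps_nth (H j * PC_hat_gf (k - 1) (- 1) a) N)"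
    unfolding fps_add_nth .
  moreover have "f * x + f * y = u * (d * (f * p)) + v * (d * (f * q))"
    if "x + y = d * (u * p + v * q)" for f x y d u v p q :: complex
    unfolding distrib_left[symmetric] that by (simp add: algebra_simps)
  ultimately show ?thesis
    unfolding s1 s2 s3 by blast
qed

end
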